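(* For every nonnegative integer $N$ and every real number $s$ with $1\le s\le 2$, $$\sum_{k=0}^N\binom{N}{k}k^s\le N^{2-s}\,(N+N^2)^{s-1}\,2^{N-s}.$$
   Context: Powers are real powers of nonnegative real numbers, with the convention $0^0=1$ (relevant only when $N=0$). *)

theory Defs
  imports Complex_Main
begin

text \<open>The library's \<^const>\<open>powr\<close> has \<^prop>\<open>(0::real) powr 0 = 0\<close>; the convention here is \<open>0\<^sup>0 = 1\<close>.
  Only meant for nonnegative bases.\<close>

definition rpow :: "real \<Rightarrow> real \<Rightarrow> real"  (infixr "rpow" 80) where
  "x rpow a = (if x = 0 \<and> a = 0 then 1 else x powr a)"

end

theory Submission
  imports Defs "HOL-Analysis.Convex"
begin

text \<open>For \<open>N = 0\<close> the left-hand side is \<open>0\<close>. For \<open>N > 0\<close>, weight each \<open>k\<close> by \<open>k (N choose k)\<close>. The total weight is \<open>N 2\<^sup>N / 2\<close> and the mean of \<open>k\<close>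
  under these weights is \<open>M = (N + 1) / 2\<close>, by the first two moments of the binomial coefficients
  (\<open>sum_binomial_times_index\<close>, \<open>sum_binomial_times_index_square\<close>). Since \<open>k\<^sup>s = k k\<^sup>s\<^sup>-\<^sup>1\<close> and
  \<open>x \<mapsto> x\<^sup>s\<^sup>-\<^sup>1\<close> is concave for \<open>1 \<le> s \<le> 2\<close>, Jensen's inequality bounds the left-hand side by
  \<open>M\<^sup>s\<^sup>-\<^sup>1 N 2\<^sup>N / 2\<close>, and this equals the right-hand side. Jensen's inequality is applied in the form
  of its proof: the concave function lies below its tangent at \<open>M\<close>
  (\<open>powr_le_tangent\<close>), and the linear term of the tangent averages out.\<close>

lemma sum_binomial_times_index:
  "(\<Sum>k\<le>N. real (N choose k) * real k) = real N * 2 ^ N / 2"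
proof -
  have "(\<Sum>k\<le>N. real (N choose k) * real k) = real (\<Sum>k\<le>N. k * (N choose k))"
    by (simp add: mult.commute)
  also have "\<dots> = real N * 2 ^ N / 2"
    unfolding choose_linear_sum by (cases N) (simp_all add: algebra_simps)
  finally show ?thesis .
qed

text \<open>Absorption, \<open>k (N choose k) = N (N - 1 choose k - 1)\<close>, removes one factor \<open>k\<close> and so reduces
  the second moment to the first.\<close>

lemma sum_binomial_times_index_square:
  "(\<Sum>k\<le>N. real (N choose k) * (real k)\<^sup>2) = real N * (real N + 1) * 2 ^ N / 4"
proof (cases N)
  case (Suc n)
  have absorb: "real (Suc n choose Suc j) * (real (Suc j))\<^sup>2
      = real (Suc n) * (real (n choose j) * real j + real (n choose j))" for j
  proof -
    have "real (Suc j) * real (Suc n choose Suc j) = real (Suc n) * real (n choose j)"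
      by (metis Suc_times_binomial of_nat_mult)
    moreover have "(real (Suc n choose Suc j)) * (real (Suc j))\<^sup>2
        = (real (Suc j) * real (Suc n choose Suc j)) * (real j + 1)"
      by (simp add: power2_eq_square mult_ac add.commute del: binomial_Suc_Suc)
    ultimately show ?thesis
      by (simp add: algebra_simps del: binomial_Suc_Suc)
  qed
  have row: "(\<Sum>j\<le>n. real (n choose j)) = 2 ^ n"
    using choose_row_sum[of n] by (metis of_nat_sum of_nat_power of_nat_numeral)
  have "(\<Sum>k\<le>Suc n. real (Suc n choose k) * (real k)\<^sup>2)
      = (\<Sum>j\<le>n. real (Suc n choose Suc j) * (real (Suc j))\<^sup>2)"
    by (subst sum.atMost_Suc_shift) simp
  also have "\<dots> = real (Suc n) * (real n * 2 ^ n / 2 + 2 ^ n)"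
    unfolding absorb
    by (simp only: sum_distrib_left[symmetric] sum.distrib sum_binomial_times_index row)
  finally show ?thesis
    using Suc by (simp add: field_simps)
qed simp

text \<open>The right-hand side is the tangent at \<open>M\<close>; the inequality is weighted AM-GM for
  \<open>x / M\<close> and \<open>1\<close>.\<close>

lemma powr_le_tangent:
  fixes x M a :: real
  assumes "0 < x" "0 < M" "0 \<le> a" "a \<le> 1"
  shows "x powr a \<le> M powr a * (a * (x / M) + (1 - a))"
proof -
  have "(x / M) powr a * 1 powr (1 - a) \<le> a * (x / M) + (1 - a) * 1"
    using assms by (intro Youngs_inequality_0) auto
  then have "(x / M) powr a \<le> a * (x / M) + (1 - a)"
    by simp
  then have "M powr a * (x / M) powr a \<le> M powr a * (a * (x / M) + (1 - a))"
    by (rule mult_left_mono) simp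
  moreover have "M powr a * (x / M) powr a = x powr a"
    using assms by (simp add: powr_divide)
  ultimately show ?thesis by simp
qed

theorem mainTheorem3:
  fixes N :: nat and s :: real
  assumes "1 \<le> s" and "s \<le> 2"
  shows "(\<Sum>k=0..N. real (N choose k) * (real k rpow s))
    \<le> (real N rpow (2 - s)) * ((real N + (real N)\<^sup>2) rpow (s - 1)) * (2 rpow (real N - s))"
proof (cases "N = 0")
  case True
  then show ?thesis
    using assms by (simp add: rpow_def)
next
  case False
  define M where "M = (real N + 1) / 2"
  have M: "0 < M" by (simp add: M_def)
  have pointwise: "real k rpow s
      \<le> M powr (s - 1) * ((s - 1) / M * (real k)\<^sup>2 + (2 - s) * real k)" for k
  proof (cases "k = 0")
    case True
    then show ?thesis using assms by (simp add: rpow_def)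
  next
    case False
    have "real k powr (s - 1) \<le> M powr (s - 1) * ((s - 1) * (real k / M) + (1 - (s - 1)))"
      using False M assms by (intro powr_le_tangent) auto
    then have "real k * real k powr (s - 1)
        \<le> real k * (M powr (s - 1) * ((s - 1) * (real k / M) + (1 - (s - 1))))"
      by (rule mult_left_mono) simp
    moreover have "real k rpow s = real k * real k powr (s - 1)"
      using False by (simp add: rpow_def powr_diff)
    ultimately show ?thesis
      by (simp add: power2_eq_square algebra_simps)
  qed
  have "(\<Sum>k=0..N. real (N choose k) * (real k rpow s))
      \<le> (\<Sum>k\<le>N. real (N choose k) *
          (M powr (s - 1) * ((s - 1) / M * (real k)\<^sup>2 + (2 - s) * real k)))"
    unfolding atLeast0AtMost by (intro sum_mono mult_left_mono pointwise) simp
  also have "\<dots> = M powr (s - 1) *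
      ((s - 1) / M * (\<Sum>k\<le>N. real (N choose k) * (real k)\<^sup>2)
        + (2 - s) * (\<Sum>k\<le>N. real (N choose k) * real k))"
    by (simp add: sum_distrib_left sum.distrib[symmetric] algebra_simps)
  also have "\<dots> = M powr (s - 1) * (real N * 2 ^ N / 2)"
  proof -
    have second: "real N * (real N + 1) * 2 ^ N / 4 = M * (real N * 2 ^ N / 2)"
      by (simp add: M_def)
    show ?thesis
      unfolding sum_binomial_times_index sum_binomial_times_index_square second
      using M by (simp add: field_simps)
  qed
  also have "\<dots> = (real N rpow (2 - s)) * ((real N + (real N)\<^sup>2) rpow (s - 1)) * (2 rpow (real N - s))"
  proof -
    have "real N + (real N)\<^sup>2 = 2 * (real N * M)"
      by (simp add: M_def power2_eq_square algebra_simps)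
    then have base: "(real N + (real N)\<^sup>2) rpow (s - 1)
        = 2 powr (s - 1) * (real N powr (s - 1) * M powr (s - 1))"
      using False M by (simp add: rpow_def powr_mult)
    have "real N powr (2 - s) * real N powr (s - 1) = real N"
      using False by (simp flip: powr_add)
    moreover have "2 powr (s - 1) * 2 powr (real N - s) = 2 ^ N / (2::real)"
      by (simp flip: powr_add add: powr_diff powr_realpow)
    ultimately have "M powr (s - 1) * (real N * 2 ^ N / 2) = M powr (s - 1)
        * ((real N powr (2 - s) * real N powr (s - 1)) * (2 powr (s - 1) * 2 powr (real N - s)))"
      by simp
    then show ?thesis
      unfolding base using False by (simp add: rpow_def mult_ac)
  qed
  finally show ?thesis .
qed

end
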